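(* Let $m$ and $n$ be positive integers with $m \leq n$. Then the Jordan partition $\lambda(m,n,2)$ is standard if and only if one of the following three conditions holds: (1) $m=1$; (2) $m=2$ and $n$ is odd; (3) $m=3$ and $n=6+4k$ for a nonnegative integer $k$.
   Context: For a prime $p$ and a positive integer $s$, let $J_s$ denote the $s\times s$ Jordan block with eigenvalue $1$ over a field $F$ of characteristic $p$. For positive integers $m \leq n$, the tensor (Kronecker) product $J_m\otimes J_n$ is similar over $F$ to a direct sum of exactly $m$ Jordan blocks $J_{\lambda_1}\oplus\cdots\oplus J_{\lambda_m}$ with $\lambda_1\geq\lambda_2\geq\dots\geq\lambda_m>0$ and $\lambda_1+\dots+\lambda_m=mn$; the sizes $\lambda_i$ depend only on $m$, $n$, $p$. The Jordan partition is $\lambda(m,n,p)=(\lambda_1,\dots,\lambda_m)$, a partition of $mn$ into $m$ parts. The Jordan partition $\lambda(m,n,p)$ is called standard if and only if $\lambda_i=m+n-2i+1$ for all $i=1,\dots,m$. *)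

theory Defs
  imports
    Jordan_Normal_Form.Jordan_Normal_Form_Existence
    Jordan_Normal_Form.Jordan_Normal_Form_Uniqueness
begin

definition kronecker :: "'a :: semiring_1 mat \<Rightarrow> 'a mat \<Rightarrow> 'a mat" where
  "kronecker A B = mat (dim_row A * dim_row B) (dim_col A * dim_col B)
     (\<lambda>(i, j). A $$ (i div dim_row B, j div dim_col B) * B $$ (i mod dim_row B, j mod dim_col B))"

(* The predicate jordan_nf demands that the listed blocks be nonempty and that their direct sum
   be similar to the given matrix. *)
definition is_jordan_partition :: "'a :: field itself \<Rightarrow> nat \<Rightarrow> nat \<Rightarrow> nat list \<Rightarrow> bool" where
  "is_jordan_partition F m n l \<longleftrightarrow>
     sorted_wrt (\<ge>) l \<and>
     jordan_nf (kronecker (jordan_block m (1 :: 'a)) (jordan_block n 1)) (map (\<lambda>s. (s, 1)) l)"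

(* The prime p enters only as the characteristic of the field F. The description below is proper:
   see is_jordan_partition_ex1. *)
definition jordan_partition :: "'a :: field itself \<Rightarrow> nat \<Rightarrow> nat \<Rightarrow> nat list" where
  "jordan_partition F m n = (THE l. is_jordan_partition F m n l)"

(* The parts are numbered from 1, the entries of a list from 0. *)
definition standard_partition :: "nat \<Rightarrow> nat \<Rightarrow> nat list \<Rightarrow> bool" where
  "standard_partition m n l \<longleftrightarrow>
     length l = m \<and> (\<forall>i\<in>{1..m}. int (l ! (i - 1)) = int m + int n - 2 * int i + 1)"

lemma jordan_matrix_append:
  "jordan_matrix (xs @ ys) =
     four_block_mat (jordan_matrix xs) (0\<^sub>m (sum_list (map fst xs)) (sum_list (map fst ys)))
       (0\<^sub>m (sum_list (map fst ys)) (sum_list (map fst xs))) (jordan_matrix ys)"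
  using jordan_matrix_dim[of xs] jordan_matrix_dim[of ys]
  unfolding jordan_matrix_def map_append diag_block_mat_append Let_def by metis

lemma similar_mat_swap_blocks:
  fixes A :: "'a :: comm_ring_1 mat"
  assumes A: "A \<in> carrier_mat n n" and B: "B \<in> carrier_mat m m"
  shows "similar_mat (four_block_mat A (0\<^sub>m n m) (0\<^sub>m m n) B)
           (four_block_mat B (0\<^sub>m m n) (0\<^sub>m n m) A)"
proof -
  define P where "P = four_block_mat (0\<^sub>m n m) (1\<^sub>m n) (1\<^sub>m m) (0\<^sub>m m n :: 'a mat)"
  define Q where "Q = four_block_mat (0\<^sub>m m n) (1\<^sub>m m) (1\<^sub>m n) (0\<^sub>m n m :: 'a mat)"
  let ?B = "four_block_mat B (0\<^sub>m m n) (0\<^sub>m n m) A"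
  have PQ: "P * Q = 1\<^sub>m (n + m)" unfolding P_def Q_def
    by (subst mult_four_block_mat[of _ n m _ n _ m _ _ n _ m]) auto
  have QP: "Q * P = 1\<^sub>m (m + n)" unfolding P_def Q_def
    by (subst mult_four_block_mat[of _ m n _ m _ n _ _ m _ n]) auto
  have "P * ?B = four_block_mat (0\<^sub>m n m) A B (0\<^sub>m m n)" unfolding P_def
    using A B by (subst mult_four_block_mat[of _ n m _ n _ m _ _ m _ n]) auto
  then have "P * ?B * Q = four_block_mat A (0\<^sub>m n m) (0\<^sub>m m n) B" unfolding Q_def
    using A B by (simp, subst mult_four_block_mat[of _ n m _ n _ m _ _ n _ m]) auto
  moreover have "{four_block_mat A (0\<^sub>m n m) (0\<^sub>m m n) B, ?B, P, Q} \<subseteq> carrier_mat (n + m) (n + m)"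
    using A B by (auto simp: P_def Q_def add.commute intro: four_block_carrier_mat)
  ultimately show ?thesis using PQ QP by (intro similar_matI[of _ _ P Q "n + m"]) (auto simp: add.commute)
qed

lemma jordan_matrix_similar_congruence:
  assumes "similar_mat (jordan_matrix xs) (jordan_matrix (xs' :: (nat \<times> 'a :: field) list))"
    and "similar_mat (jordan_matrix ys) (jordan_matrix ys')"
  shows "similar_mat (jordan_matrix (xs @ ys)) (jordan_matrix (xs' @ ys'))"
proof -
  have "similar_mat (diag_block_mat (map fst [(jordan_matrix xs, jordan_matrix xs'),
            (jordan_matrix ys, jordan_matrix ys')]))
          (diag_block_mat (map snd [(jordan_matrix xs, jordan_matrix xs'),
            (jordan_matrix ys, jordan_matrix ys')]))"
    by (rule similar_diag_mat_block_mat) (use assms in auto)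
  then show ?thesis
    using jordan_matrix_concat_diag_block_mat[of "[xs, ys]"]
      jordan_matrix_concat_diag_block_mat[of "[xs', ys']"] by simp
qed

lemma jordan_matrix_similar_refl:
  "similar_mat (jordan_matrix (xs :: (nat \<times> 'a :: field) list)) (jordan_matrix xs)"
  by (rule similar_mat_refl[OF jordan_matrix_carrier])

lemma jordan_matrix_similar_mset:
  fixes xs ys :: "(nat \<times> 'a :: field) list"
  assumes "mset xs = mset ys"
  shows "similar_mat (jordan_matrix xs) (jordan_matrix ys)"
  using assms
proof (induction xs arbitrary: ys)
  case Nil
  then show ?case using jordan_matrix_similar_refl[of "[]"] by simp
next
  case (Cons x xs)
  then have "x \<in> set ys" by (metis list.set_intros(1) set_mset_mset)
  then obtain us vs where ys: "ys = us @ x # vs" by (meson split_list)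
  have "similar_mat (jordan_matrix xs) (jordan_matrix (us @ vs))"
    using Cons by (simp add: ys)
  then have 1: "similar_mat (jordan_matrix ([x] @ xs)) (jordan_matrix ([x] @ (us @ vs)))"
    by (intro jordan_matrix_similar_congruence jordan_matrix_similar_refl)
  have "similar_mat (jordan_matrix ([x] @ us)) (jordan_matrix (us @ [x]))"
    unfolding jordan_matrix_append
    by (rule similar_mat_swap_blocks[OF jordan_matrix_carrier jordan_matrix_carrier])
  then have 2: "similar_mat (jordan_matrix (([x] @ us) @ vs)) (jordan_matrix ((us @ [x]) @ vs))"
    by (rule jordan_matrix_similar_congruence[OF _ jordan_matrix_similar_refl])
  from 1 2 show ?case using similar_mat_trans by (fastforce simp: ys)
qed

lemma kronecker_jordan_blocks_carrier:
  "kronecker (jordan_block m (a :: 'a :: field)) (jordan_block n b) \<in> carrier_mat (m * n) (m * n)"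
  by (rule carrier_matI) (simp_all add: kronecker_def)

lemma kronecker_jordan_blocks_upper_triangular:
  "upper_triangular (kronecker (jordan_block m (a :: 'a :: field)) (jordan_block n b))"
  unfolding upper_triangular_def
proof (intro allI impI)
  fix i j
  assume "i < dim_row (kronecker (jordan_block m a) (jordan_block n b))" and ji: "j < i"
  then have i: "i < m * n" by (simp add: kronecker_def)
  then have j: "j < m * n" using ji by simp
  have n: "n > 0" using i by (cases n) auto
  have b: "i div n < m" "j div n < m" "i mod n < n" "j mod n < n"
    using i j n by (simp_all add: less_mult_imp_div_less)
  have d: "j div n \<le> i div n" using ji by (simp add: div_le_mono)
  show "kronecker (jordan_block m a) (jordan_block n b) $$ (i, j) = 0"
  proof (cases "j div n = i div n")
    case True
    have "n * (i div n) + i mod n = i" "n * (j div n) + j mod n = j" by simp_all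
    then have "j mod n < i mod n" using ji True by (metis add_less_cancel_left)
    then show ?thesis using i j b by (simp add: kronecker_def)
  next
    case False
    then show ?thesis using i j b d by (simp add: kronecker_def)
  qed
qed

lemma diag_kronecker_jordan_blocks:
  assumes "a \<in> set (diag_mat (kronecker (jordan_block m (1 :: 'a :: field)) (jordan_block n 1)))"
  shows "a = 1"
proof -
  from assms obtain i where i: "i < m * n"
    and a: "a = kronecker (jordan_block m (1 :: 'a)) (jordan_block n 1) $$ (i, i)"
    by (auto simp: diag_mat_def kronecker_def)
  have "n > 0" using i by (cases n) auto
  then have "i div n < m" "i mod n < n"
    using i by (simp_all add: less_mult_imp_div_less)
  then show ?thesis using i a by (simp add: kronecker_def)
qed

lemma is_jordan_partition_exists: "\<exists>l. is_jordan_partition TYPE('a :: field) m n l"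
proof -
  let ?A = "kronecker (jordan_block m (1 :: 'a)) (jordan_block n 1)"
  note A = kronecker_jordan_blocks_carrier[of m "1 :: 'a" n 1]
  note ut = kronecker_jordan_blocks_upper_triangular[of m "1 :: 'a" n 1]
  obtain xs where xs: "jordan_nf ?A xs"
    using triangular_to_jnf_vector[OF A ut] by blast
  have one: "snd x = 1" if x: "x \<in> set xs" for x
  proof -
    obtain k e where ke: "x = (k, e)" by (cases x)
    have k: "k \<noteq> 0" using xs x ke unfolding jordan_nf_def by force
    have "poly (char_poly ?A) e = 0"
      unfolding jordan_nf_char_poly[OF xs] poly_prod_list prod_list_zero_iff
      using x k ke by (force simp: poly_power)
    then have "e \<in> set (diag_mat ?A)"
      unfolding char_poly_upper_triangular[OF A ut] poly_prod_list prod_list_zero_iff by auto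
    then show ?thesis using diag_kronecker_jordan_blocks ke by auto
  qed
  define l where "l = rev (sort (map fst xs))"
  have "mset (map (\<lambda>s. (s, 1 :: 'a)) l) = mset (map (\<lambda>s. (s, 1)) (map fst xs))"
    by (simp add: l_def multiset.map_comp)
  also have "map (\<lambda>s. (s, 1 :: 'a)) (map fst xs) = xs"
    using one by (auto intro!: map_idI simp: comp_def prod_eq_iff)
  finally have ms: "mset (map (\<lambda>s. (s, 1 :: 'a)) l) = mset xs" .
  have "jordan_nf ?A (map (\<lambda>s. (s, 1)) l)"
    using xs jordan_matrix_similar_mset[OF ms[symmetric]] mset_eq_setD[OF ms]
    unfolding jordan_nf_def by (metis similar_mat_trans)
  moreover have "sorted_wrt (\<ge>) l"
    by (simp add: l_def sorted_wrt_rev)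
  ultimately show ?thesis unfolding is_jordan_partition_def by blast
qed

lemma is_jordan_partition_unique:
  assumes l: "is_jordan_partition TYPE('a :: field) m n l"
    and l': "is_jordan_partition TYPE('a) m n l'"
  shows "l = l'"
proof -
  have cnt: "count (mset xs) k = (if k = 0 then 0 else
       compute_nr_of_jordan_blocks (kronecker (jordan_block m (1 :: 'a)) (jordan_block n 1)) 1 k)"
    if xs: "is_jordan_partition TYPE('a) m n xs" for xs k
  proof -
    from xs have j: "jordan_nf (kronecker (jordan_block m (1 :: 'a)) (jordan_block n 1))
       (map (\<lambda>s. (s, 1)) xs)" unfolding is_jordan_partition_def by blast
    show ?thesis
    proof (cases "k = 0")
      case True
      then show ?thesis using j by (force simp: jordan_nf_def count_eq_zero_iff)
    next
      case False
      have "length (filter ((=) (k, 1 :: 'a)) (map (\<lambda>s. (s, 1)) xs)) = count (mset xs) k"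
        by (induction xs) auto
      then show ?thesis using compute_nr_of_jordan_blocks[OF j False, of 1] False by simp
    qed
  qed
  have "mset l = mset l'" using cnt[OF l] cnt[OF l'] by (intro multiset_eqI) simp
  moreover have "sorted (rev l)" "sorted (rev l')"
    using l l' unfolding is_jordan_partition_def by (simp_all add: sorted_wrt_rev)
  ultimately have "rev l = rev l'"
    by (metis mset_rev properties_for_sort)
  then show ?thesis by simp
qed

lemma is_jordan_partition_ex1: "\<exists>!l. is_jordan_partition TYPE('a :: field) m n l"
  using is_jordan_partition_exists is_jordan_partition_unique by blast

end

(*
The matrix of J_m (x) J_n - 1 represents multiplication by N = (1+x)(1+y) - 1 = x + y + xy on
F[x,y]/(x^m, y^n), so the partition is encoded by the ranks of the powers of N.

Necessity. Since N lies in (x,y), the image of N^k with k = m+n-2-2d is spanned by the images of the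
monomials of degree <= d and by the monomials of degree >= m+n-1-d; these are (d+1)^2 vectors, and
(d+1)^2 is exactly the rank in the standard case. Hence the partition is not standard as soon as
N^k kills some monomial of degree d < m. In characteristic 2 squaring maps the ideal (x^a, y^b) into
(x^2a, y^2b), so such a vanishing for (a,b) is inherited by (m,n) with m near 2a and n near 2b.
If m and n are both even, the square of the relation N^(m/2+n/2-1) = 0 starts the process; two
doubling steps reach all remaining nonstandard cases.

Sufficiency. In the cases m = 2, n odd and m = 3, n = 6+4k the top powers of N are explicit, because
N^2 = y^2 mod x^2 and N^4 = y^4 mod x^3, and their ranks determine the partition.
*)
theory Submission
  imports Defs "Jordan_Normal_Form.DL_Rank"
begin

subsection \<open>Kernel dimensions and linear functionals\<close>

text \<open>Pivots of the row echelon form lie in distinct rows, so there are at most r of them, and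
  the kernel dimension is the number of columns without a pivot.\<close>

lemma kernel_dim_ge_cols_minus_rows:
  fixes C :: "'a :: field mat"
  assumes C: "C \<in> carrier_mat r nc"
  shows "nc \<le> kernel_dim C + r"
proof -
  obtain B where B: "gauss_jordan_single C = B" by blast
  from gauss_jordan_single[OF C B] have Bc: "B \<in> carrier_mat r nc" and row: "row_echelon_form B"
    by auto
  then obtain p where "pivot_fun B p nc" unfolding row_echelon_form_def by auto
  from pivot_positions(4)[OF Bc this] have "length (pivot_positions B) \<le> card {..<r}"
    using card_mono[of "{..<r}" "{i. i < r \<and> row B i \<noteq> 0\<^sub>v nc}"] by auto
  then show ?thesis using C B by (simp add: kernel_dim_code)
qed

text \<open>Independence is expressed in the ambient space rather than in the kernel, so that the
  same basis can be used inside the kernel of another matrix.\<close>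

lemma kernel_dim_basis:
  fixes A :: "'a :: field mat"
  assumes A: "A \<in> carrier_mat nr nc"
  obtains B where "finite B" "card B = kernel_dim A" "B \<subseteq> mat_kernel A"
    "\<not> module.lin_dep class_ring (module_vec TYPE('a) nc) B"
proof -
  interpret kernel nr nc A by (unfold_locales, rule A)
  obtain B where B: "finite B" "basis B" using kernel_basis_exists[OF A] by blast
  then have sub: "B \<subseteq> mat_kernel A" and "lin_indpt B" unfolding Ker.basis_def by auto
  then have "\<not> NC.lin_dep B" using lindep_same[OF sub] by simp
  moreover have "card B = kernel_dim A" using Ker.dim_basis[OF B] by simp
  ultimately show ?thesis by (intro that[OF B(1) _ sub])
qed

lemma kernel_dim_mono:
  fixes A :: "'a :: field mat"
  assumes A: "A \<in> carrier_mat nr nc" and C: "C \<in> carrier_mat r nc"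
    and sub: "mat_kernel C \<subseteq> mat_kernel A"
  shows "kernel_dim C \<le> kernel_dim A"
proof -
  interpret kernel nr nc A by (unfold_locales, rule A)
  obtain B where B: "card B = kernel_dim C" "B \<subseteq> mat_kernel C" "\<not> NC.lin_dep B"
    using kernel_dim_basis[OF C] .
  have BA: "B \<subseteq> mat_kernel A" using B(2) sub by (rule subset_trans)
  have li: "lin_indpt B" using B(3) lindep_same[OF BA] by simp
  obtain B' where "finite B'" "basis B'" using kernel_basis_exists[OF A] by blast
  then have "Ker.fin_dim" unfolding Ker.fin_dim_def Ker.basis_def by blast
  from Ker.li_le_dim(2)[OF this BA li] show ?thesis unfolding B(1) kernel_dim .
qed

lemma kernel_nontrivial:
  fixes C :: "'a :: field mat"
  assumes C: "C \<in> carrier_mat r nc" and "r < nc"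
  obtains v where "v \<in> carrier_vec nc" "v \<noteq> 0\<^sub>v nc" "C *\<^sub>v v = 0\<^sub>v r"
proof -
  interpret kernel r nc C by (unfold_locales, rule C)
  obtain B where B: "card B = kernel_dim C" "B \<subseteq> mat_kernel C" "\<not> NC.lin_dep B"
    using kernel_dim_basis[OF C] .
  have "card B \<noteq> 0" using kernel_dim_ge_cols_minus_rows[OF C] B assms by simp
  then obtain b where b: "b \<in> B" by fastforce
  have "b \<noteq> 0\<^sub>v nc"
  proof
    assume "b = 0\<^sub>v nc"
    then have "0\<^sub>v nc \<in> B" using b by simp
    moreover have "B \<subseteq> carrier_vec nc" using B(2) mat_kernel_carrier[OF C] by blast
    moreover have "(UNIV :: 'a set) \<noteq> {0}" by (metis UNIV_I singletonD zero_neq_one)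
    ultimately show False using NC.zero_nin_lin_indpt[of B] B(3) by simp
  qed
  moreover have "b \<in> mat_kernel C" using b B(2) by blast
  ultimately show ?thesis using that mat_kernelD[OF C] by blast
qed

text \<open>If the functionals in W separate the points of the kernel, the kernel embeds into a
  space of dimension \<open>card W\<close>. Otherwise a nonzero combination of basis vectors of the
  kernel would be annihilated by all of W.\<close>

lemma kernel_dim_le_card_functionals:
  fixes A :: "'a :: field mat"
  assumes A: "A \<in> carrier_mat nr nc" and W: "finite W" "W \<subseteq> carrier_vec nc"
    and inj: "\<And>v. v \<in> carrier_vec nc \<Longrightarrow> A *\<^sub>v v = 0\<^sub>v nr \<Longrightarrow> (\<And>w. w \<in> W \<Longrightarrow> w \<bullet> v = 0) \<Longrightarrow> v = 0\<^sub>v nc"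
  shows "kernel_dim A \<le> card W"
proof (rule ccontr)
  interpret vec_space "TYPE('a)" nc .
  assume less: "\<not> ?thesis"
  obtain ws where ws: "set ws = W" "length ws = card W"
    using finite_distinct_list[OF W(1)] by (auto dest: distinct_card)
  define C where "C = mat_of_rows nc ws"
  have C: "C \<in> carrier_mat (card W) nc" by (simp add: C_def ws(2)[symmetric])
  obtain B where B: "finite B" "card B = kernel_dim A" "B \<subseteq> mat_kernel A" "\<not> lin_dep B"
    using kernel_dim_basis[OF A] .
  obtain bs where bs: "set bs = B" "distinct bs" using finite_distinct_list[OF B(1)] by blast
  have len: "length bs = kernel_dim A" using distinct_card[OF bs(2)] bs B by simp
  have bsc: "set bs \<subseteq> carrier_vec nc" using bs B mat_kernel_carrier[OF A] by auto
  define M where "M = mat_of_cols nc bs"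
  have M: "M \<in> carrier_mat nc (kernel_dim A)" by (simp add: M_def len[symmetric])
  have cols: "cols M = bs" using bsc by (simp add: M_def)
  \<comment> \<open>The rows of \<open>C\<close> are the functionals and the columns of
    \<open>M\<close> a basis of the kernel. \<open>C * M\<close> has fewer rows than columns, so
    some nonzero c solves the homogeneous system.\<close>
  obtain c where c: "c \<in> carrier_vec (kernel_dim A)" "c \<noteq> 0\<^sub>v (kernel_dim A)"
    "(C * M) *\<^sub>v c = 0\<^sub>v (card W)"
    using kernel_nontrivial[of "C * M" "card W" "kernel_dim A"] C M less by auto
  have Mc: "M *\<^sub>v c \<in> carrier_vec nc" using M c by auto
  have "A * M = 0\<^sub>m nr (kernel_dim A)"
  proof (rule eq_matI)
    fix i j assume "i < dim_row (0\<^sub>m nr (kernel_dim A) :: 'a mat)"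
      "j < dim_col (0\<^sub>m nr (kernel_dim A) :: 'a mat)"
    then have ij: "i < nr" "j < kernel_dim A" by auto
    have "bs ! j \<in> B" using nth_mem[of j bs] ij(2) bs(1) len by simp
    then have "bs ! j \<in> mat_kernel A" using B(3) by blast
    moreover from this have "col M j = bs ! j"
      using ij(2) len mat_kernelD(1)[OF A] by (simp add: M_def)
    ultimately have "A *\<^sub>v col M j = 0\<^sub>v nr" using mat_kernelD(2)[OF A] by simp
    then have "(A *\<^sub>v col M j) $ i = 0" using ij(1) by simp
    then have "row A i \<bullet> col M j = 0" using ij(1) A by simp
    then show "(A * M) $$ (i, j) = 0\<^sub>m nr (kernel_dim A) $$ (i, j)"
      using ij A M by simp
  qed (use A M in auto)
  then have "A *\<^sub>v (M *\<^sub>v c) = 0\<^sub>m nr (kernel_dim A) *\<^sub>v c"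
    using assoc_mult_mat_vec[OF A M c(1)] by simp
  also have "\<dots> = 0\<^sub>v nr" using c(1) by (intro eq_vecI) (auto simp: scalar_prod_def)
  finally have AMc: "A *\<^sub>v (M *\<^sub>v c) = 0\<^sub>v nr" .
  have CMc: "C *\<^sub>v (M *\<^sub>v c) = 0\<^sub>v (card W)"
    using assoc_mult_mat_vec[OF C M c(1)] c(3) by simp
  have WMc: "w \<bullet> (M *\<^sub>v c) = 0" if wW: "w \<in> W" for w
  proof -
    obtain k where k: "k < length ws" "w = ws ! k" using wW[folded ws(1)] unfolding in_set_conv_nth by blast
    have "w \<in> carrier_vec nc" using wW W by blast
    then have "row C k = w" using k by (simp add: C_def)
    moreover have "(C *\<^sub>v (M *\<^sub>v c)) $ k = 0" using CMc k ws(2) by simp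
    ultimately show ?thesis using k ws(2) C by simp
  qed
  have "M *\<^sub>v c = 0\<^sub>v nc" by (rule inj[OF Mc AMc WMc])
  then have "lin_dep (set (cols M))"
    using lin_depI[OF M c(1,2)] bs cols by simp
  then show False using B bs cols by simp
qed

text \<open>An upper bound on the rank: the common zeros of W have codimension at most
  \<open>card W\<close> and all lie in the kernel.\<close>

lemma kernel_dim_ge_card_functionals:
  fixes A :: "'a :: field mat"
  assumes A: "A \<in> carrier_mat nr nc" and W: "finite W" "W \<subseteq> carrier_vec nc"
    and ker: "\<And>v. v \<in> carrier_vec nc \<Longrightarrow> (\<And>w. w \<in> W \<Longrightarrow> w \<bullet> v = 0) \<Longrightarrow> A *\<^sub>v v = 0\<^sub>v nr"
  shows "nc \<le> kernel_dim A + card W"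
proof -
  obtain ws where ws: "set ws = W" "length ws = card W"
    using finite_distinct_list[OF W(1)] by (auto dest: distinct_card)
  define C where "C = mat_of_rows nc ws"
  have C: "C \<in> carrier_mat (card W) nc" by (simp add: C_def ws(2)[symmetric])
  have "mat_kernel C \<subseteq> mat_kernel A"
  proof
    fix v assume v: "v \<in> mat_kernel C"
    have vc: "v \<in> carrier_vec nc" "C *\<^sub>v v = 0\<^sub>v (card W)" using mat_kernelD[OF C v] by auto
    have "w \<bullet> v = 0" if wW: "w \<in> W" for w
    proof -
      obtain k where k: "k < length ws" "w = ws ! k" using wW[folded ws(1)] unfolding in_set_conv_nth by blast
      have "w \<in> carrier_vec nc" using wW W by blast
      then have "row C k = w" using k by (simp add: C_def)
      moreover have "(C *\<^sub>v v) $ k = 0" using vc k ws(2) by simp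
      ultimately show ?thesis using k ws(2) C by simp
    qed
    then show "v \<in> mat_kernel A" using ker[OF vc(1)] mat_kernelI[OF A vc(1)] by blast
  qed
  then show ?thesis
    using kernel_dim_mono[OF A C] kernel_dim_ge_cols_minus_rows[OF C] by linarith
qed

subsection \<open>Multiplication matrices on truncated bivariate polynomials\<close>

lemma div_mod_pair_iff: "j < n \<Longrightarrow> c div n = i \<and> c mod n = j \<longleftrightarrow> c = i * n + (j :: nat)"
  using div_mult_mod_eq[of c n] by auto

lemma pair_index_less: "i < m \<Longrightarrow> j < n \<Longrightarrow> i * n + j < m * (n :: nat)"
  using mult_le_mono1[of "Suc i" m n] by simp

text \<open>An element of \<^typ>\<open>'a poly poly\<close> is a polynomial in \<open>x\<close> with coefficients in \<open>F[y]\<close>.\<close>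

abbreviation bicoeff :: "'a :: comm_ring_1 poly poly \<Rightarrow> nat \<Rightarrow> nat \<Rightarrow> 'a" where
  "bicoeff p i j \<equiv> coeff (coeff p i) j"

definition mono_xy :: "nat \<Rightarrow> nat \<Rightarrow> 'a :: comm_ring_1 poly poly" where
  "mono_xy i j = monom (monom 1 j) i"

lemma bicoeff_mono_xy_mult:
  "bicoeff (mono_xy i j * p) k l = (if i \<le> k \<and> j \<le> l then bicoeff p (k - i) (l - j) else 0)"
  by (simp add: mono_xy_def coeff_monom_mult)

lemma bicoeff_mono_xy: "bicoeff (mono_xy i j) k l = (if i = k \<and> j = l then 1 else 0)"
  by (simp add: mono_xy_def)

lemma mono_xy_mult: "mono_xy i j * mono_xy k l = mono_xy (i + k) (j + l)"
  by (simp add: mono_xy_def mult_monom)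

lemma mono_xy_0: "mono_xy 0 0 = 1"
  by (simp add: mono_xy_def one_pCons monom_0)

lemma mono_xy_power: "mono_xy i j ^ k = mono_xy (i * k) (j * k)"
  by (simp add: mono_xy_def monom_power mult.commute)

text \<open>Vanishing in F[x,y]/(x^m, y^n), read off from the coefficients.\<close>

definition box_zero :: "nat \<Rightarrow> nat \<Rightarrow> 'a :: comm_ring_1 poly poly \<Rightarrow> bool" where
  "box_zero m n p \<longleftrightarrow> (\<forall>i<m. \<forall>j<n. bicoeff p i j = 0)"

lemma box_zero_mult:
  assumes "box_zero m n p" shows "box_zero m n (p * q)"
  unfolding box_zero_def
proof (intro allI impI)
  fix i j assume "i < m" "j < n"
  then have "bicoeff p a b = 0" if "a \<le> i" "b \<le> j" for a b
    using assms that unfolding box_zero_def by (meson le_less_trans)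
  then show "bicoeff (p * q) i j = 0"
    by (simp add: coeff_mult coeff_sum)
qed

text \<open>Row convention: row \<open>i * n + j\<close> lists the coefficients of the image of \<open>x\<^sup>i y\<^sup>j\<close>, so products of
  matrices correspond to products of polynomials in the same order.\<close>

definition mult_mat :: "nat \<Rightarrow> nat \<Rightarrow> 'a :: field poly poly \<Rightarrow> 'a mat" where
  "mult_mat m n p = mat (m * n) (m * n)
     (\<lambda>(r, c). bicoeff (mono_xy (r div n) (r mod n) * p) (c div n) (c mod n))"

lemma mult_mat_carrier [simp]: "mult_mat m n p \<in> carrier_mat (m * n) (m * n)"
  by (simp add: mult_mat_def)

lemma mult_mat_dim [simp]: "dim_row (mult_mat m n p) = m * n" "dim_col (mult_mat m n p) = m * n"
  by (simp_all add: mult_mat_def)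

text \<open>Truncating the intermediate product u to the box, which gives v, loses nothing: u - v
  vanishes on the box, and hence so does (u - v) * q.\<close>

lemma mult_mat_mult: "mult_mat m n p * mult_mat m n q = mult_mat m n (p * q)"
proof (rule eq_matI)
  fix r s assume "r < dim_row (mult_mat m n (p * q))" "s < dim_col (mult_mat m n (p * q))"
  then have rs: "r < m * n" "s < m * n" by simp_all
  then have n: "0 < n" by (cases n) auto
  define u where "u = mono_xy (r div n) (r mod n) * p"
  define v where "v = (\<Sum>c<m * n. [:[:bicoeff u (c div n) (c mod n):]:] * mono_xy (c div n) (c mod n))"
  have v: "bicoeff v i j = bicoeff u i j" if ij: "i < m" "j < n" for i j
  proof -
    have "bicoeff v i j = (\<Sum>c<m * n. if c = i * n + j then bicoeff u i j else 0)"
      unfolding v_def coeff_sum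
    proof (rule sum.cong)
      fix c assume "c \<in> {..<m * n}"
      show "bicoeff ([:[:bicoeff u (c div n) (c mod n):]:] * mono_xy (c div n) (c mod n)) i j =
          (if c = i * n + j then bicoeff u i j else 0)"
        using div_mod_pair_iff[OF ij(2), of c i] by (auto simp: bicoeff_mono_xy)
    qed simp
    also have "\<dots> = bicoeff u i j" using pair_index_less[OF ij] by simp
    finally show ?thesis .
  qed
  have "box_zero m n (u - v)" by (simp add: box_zero_def v)
  then have "box_zero m n ((u - v) * q)" by (rule box_zero_mult)
  moreover have "s div n < m" "s mod n < n" using rs n by (simp_all add: less_mult_imp_div_less)
  ultimately have "bicoeff (u * q) (s div n) (s mod n) = bicoeff (v * q) (s div n) (s mod n)"
    by (simp add: box_zero_def left_diff_distrib)
  also have "\<dots> = (\<Sum>c<m * n. bicoeff u (c div n) (c mod n) *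
      bicoeff (mono_xy (c div n) (c mod n) * q) (s div n) (s mod n))"
    by (simp add: v_def sum_distrib_right coeff_sum)
  finally show "(mult_mat m n p * mult_mat m n q) $$ (r, s) = mult_mat m n (p * q) $$ (r, s)"
    using rs by (simp add: mult_mat_def u_def scalar_prod_def atLeast0LessThan mult.assoc)
qed simp_all

lemma mult_mat_1: "mult_mat m n 1 = 1\<^sub>m (m * n)"
proof (rule eq_matI)
  fix r c assume "r < dim_row (1\<^sub>m (m * n) :: 'a mat)" "c < dim_col (1\<^sub>m (m * n) :: 'a mat)"
  moreover have "(r div n = c div n \<and> r mod n = c mod n) = (r = c)" by (metis div_mult_mod_eq)
  ultimately show "mult_mat m n 1 $$ (r, c) = (1\<^sub>m (m * n) :: 'a mat) $$ (r, c)"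
    by (simp add: mult_mat_def bicoeff_mono_xy)
qed simp_all

lemma mult_mat_power: "mult_mat m n p ^\<^sub>m k = mult_mat m n (p ^ k)"
  by (induction k) (simp_all add: mult_mat_1 mult_mat_mult mult.commute)

section \<open>The nilpotent element (1+x)(1+y) - 1 and its multiplication matrix\<close>

definition nilp :: "'a :: comm_ring_1 poly poly" where
  "nilp = [:[:0, 1:], [:1, 1:]:]"

lemma nilp_eq: "nilp = mono_xy 1 0 * (1 + mono_xy 0 1) + mono_xy 0 1"
  by (simp add: nilp_def mono_xy_def monom_altdef one_pCons)

lemma bicoeff_nilp: "bicoeff nilp i j = (if (i, j) \<in> {(0, 1), (1, 0), (1, 1)} then 1 else 0)"
  by (auto simp: nilp_def coeff_pCons split: nat.splits)

text \<open>A Jordan block with eigenvalue 1 is the matrix of multiplication by 1+x, so the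
  Kronecker product is that of (1+x)(1+y). Passing to \<open>char_matrix\<close> at 1 subtracts the
  identity.\<close>

lemma char_matrix_kronecker:
  "char_matrix (kronecker (jordan_block m (1 :: 'a :: field)) (jordan_block n 1)) 1 = mult_mat m n nilp"
proof (rule eq_matI)
  fix r c assume "r < dim_row (mult_mat m n (nilp :: 'a poly poly))" "c < dim_col (mult_mat m n (nilp :: 'a poly poly))"
  then have rc: "r < m * n" "c < m * n" by simp_all
  then have n: "0 < n" by (cases n) auto
  have eq: "(r div n = c div n \<and> r mod n = c mod n) = (r = c)" by (metis div_mult_mod_eq)
  have b: "r div n < m" "c div n < m" "r mod n < n" "c mod n < n"
    using rc n by (simp_all add: less_mult_imp_div_less)
  have "char_matrix (kronecker (jordan_block m (1 :: 'a)) (jordan_block n 1)) 1 $$ (r, c) =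
    (if r div n = c div n \<or> Suc (r div n) = c div n then 1 else 0) *
    (if r mod n = c mod n \<or> Suc (r mod n) = c mod n then 1 else 0) -
    (if r div n = c div n \<and> r mod n = c mod n then 1 else 0)"
    using rc b unfolding eq by (auto simp: char_matrix_def kronecker_def)
  also have "\<dots> = bicoeff (mono_xy (r div n) (r mod n) * nilp) (c div n) (c mod n)"
    unfolding bicoeff_mono_xy_mult bicoeff_nilp by auto
  finally show "char_matrix (kronecker (jordan_block m (1 :: 'a)) (jordan_block n 1)) 1 $$ (r, c) =
    mult_mat m n nilp $$ (r, c)"
    using rc by (simp add: mult_mat_def)
qed (simp_all add: char_matrix_def kronecker_def)

text \<open>A nilpotent Jordan block of size s contributes \<open>min k s\<close> to the kernel of
  the k-th power. All information about the parts enters the proof through this sum.\<close>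

lemma kernel_dim_jordan_partition:
  assumes "is_jordan_partition TYPE('a :: field) m n l"
  shows "kernel_dim (mult_mat m n (nilp ^ k :: 'a poly poly)) = (\<Sum>s\<leftarrow>l. min k s)"
proof -
  have "jordan_nf (kronecker (jordan_block m (1 :: 'a)) (jordan_block n 1)) (map (\<lambda>s. (s, 1)) l)"
    using assms by (simp add: is_jordan_partition_def)
  from dim_gen_eigenspace[OF this, of 1 k] show ?thesis
    by (simp add: dim_gen_eigenspace_def char_matrix_kronecker mult_mat_power filter_map comp_def)
qed

lemma sum_list_jordan_partition:
  assumes "is_jordan_partition TYPE('a :: field) m n l"
  shows "sum_list l = m * n"
proof -
  have "similar_mat (kronecker (jordan_block m (1 :: 'a)) (jordan_block n 1))
      (jordan_matrix (map (\<lambda>s. (s, 1)) l))"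
    using assms by (simp add: is_jordan_partition_def jordan_nf_def)
  then obtain d where "{kronecker (jordan_block m (1 :: 'a)) (jordan_block n 1),
      jordan_matrix (map (\<lambda>s. (s, 1)) l)} \<subseteq> carrier_mat d d"
    by (blast dest: similar_matD)
  then have "m * n = d" "sum_list (map fst (map (\<lambda>s. (s, 1 :: 'a)) l)) = d"
    using carrier_matD(1)[OF kronecker_jordan_blocks_carrier[of m "1 :: 'a" n 1]]
      jordan_matrix_dim(1)[of "map (\<lambda>s. (s, 1 :: 'a)) l"] by (metis carrier_matD(1) insert_subset)+
  then show ?thesis by (simp add: comp_def)
qed

lemma pos_jordan_partition:
  assumes "is_jordan_partition TYPE('a :: field) m n l" and "s \<in> set l"
  shows "0 < s"
  using assms by (force simp: is_jordan_partition_def jordan_nf_def)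

subsection \<open>Obstructions to standardness\<close>

text \<open>N has no constant term, so each factor raises the degree by at least one.\<close>

lemma bicoeff_nilp_power_low:
  assumes "i + j < k"
  shows "bicoeff (nilp ^ k) i j = 0"
  using assms
proof (induction k arbitrary: i j)
  case (Suc k)
  have "nilp ^ Suc k = mono_xy 1 0 * nilp ^ k + mono_xy 1 1 * nilp ^ k + mono_xy 0 1 * (nilp ^ k :: 'a poly poly)"
    by (simp add: nilp_eq mono_xy_mult algebra_simps)
  then show ?case using Suc by (simp add: bicoeff_mono_xy_mult)
qed simp

lemma card_triangle: "finite {(a, b). a + b < (e :: nat)}" "2 * card {(a, b). a + b < e} = e * (e + 1)"
proof -
  show fin: "finite {(a, b). a + b < e}" for e :: nat
    by (rule finite_subset[of _ "{..<e} \<times> {..<e}"]) auto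
  show "2 * card {(a, b). a + b < e} = e * (e + 1)"
  proof (induction e)
    case (Suc e)
    have "{(a, b). a + b < Suc e} = {(a, b). a + b < e} \<union> (\<lambda>a. (a, e - a)) ` {..e}"
      by (auto simp: image_iff less_Suc_eq)
    then have "card {(a, b). a + b < Suc e} = card {(a, b). a + b < e} + card ((\<lambda>a. (a, e - a)) ` {..e})"
      using fin[of e] by (simp, intro card_Un_disjoint) auto
    also have "card ((\<lambda>a. (a, e - a)) ` {..e}) = Suc e"
      by (subst card_image) (auto simp: inj_on_def)
    finally show ?case using Suc.IH by simp
  qed simp
qed

text \<open>The rank of N^k is controlled by the rows of degree at most d and the columns of degree
  at least m+n-1-d. Their number is at most (d+1)(d+2)/2 + d(d+1)/2 = (d+1)^2, and the row of x^i
  y^j is zero, which saves one.\<close>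

lemma kernel_dim_nilp_power_gt:
  fixes m n d :: nat
  assumes d: "i + j = d" "d < m" "m \<le> n"
    and zero: "box_zero m n (mono_xy i j * nilp ^ (m + n - 2 - 2 * d) :: 'a :: field poly poly)"
  shows "m * n < kernel_dim (mult_mat m n (nilp ^ (m + n - 2 - 2 * d) :: 'a poly poly)) + (d + 1)\<^sup>2"
proof -
  define k where "k = m + n - 2 - 2 * d"
  define M where "M = mult_mat m n (nilp ^ k :: 'a poly poly)"
  have M: "M \<in> carrier_mat (m * n) (m * n)" by (simp add: M_def)
  have n: "0 < n" using d by simp
  define T where "T = {(a, b). a + b < d + 1} - {(i, j)}"
  define U where "U = {(a, b). a < m \<and> b < n \<and> m + n - 1 - d \<le> a + b}"
  define W where "W = (\<lambda>(a, b). row M (a * n + b)) ` T \<union> (\<lambda>(a, b). unit_vec (m * n) (a * n + b)) ` U"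
  have finT: "finite T" unfolding T_def using card_triangle(1) by blast
  \<comment> \<open>The reflection of the box sends the monomials of high degree in \<open>U\<close>
    to monomials of degree below d, which bounds \<open>card U\<close>.\<close>
  have inj: "inj_on (\<lambda>(a, b). (m - 1 - a, n - 1 - b)) U" unfolding inj_on_def U_def by auto
  have sub: "(\<lambda>(a, b). (m - 1 - a, n - 1 - b)) ` U \<subseteq> {(a, b). a + b < d}"
    using d unfolding U_def by auto
  have finU: "finite U" using inj_on_finite[OF inj sub card_triangle(1)] .
  have "card U \<le> card {(a, b). a + b < d}"
    using card_inj_on_le[OF inj sub card_triangle(1)] .
  moreover have "card T = card {(a, b). a + b < d + 1} - 1"
    unfolding T_def using d card_triangle(1)[of "d + 1"] by (subst card_Diff_singleton) auto
  moreover have "card {(a, b). a + b < d + 1} > 0"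
    using card_triangle(2)[of "d + 1"] by (intro Nat.gr0I) simp
  moreover have "card W \<le> card T + card U"
    unfolding W_def using card_Un_le card_image_le[OF finT] card_image_le[OF finU]
    by (meson add_mono le_trans)
  ultimately have cardW: "card W < (d + 1)\<^sup>2"
    using card_triangle(2)[of "d + 1"] card_triangle(2)[of d] by (simp add: power2_eq_square algebra_simps)
  have T_lt: "a * n + b < m * n" if "(a, b) \<in> T" for a b
    using that d by (intro pair_index_less) (auto simp: T_def)
  have "m * n \<le> kernel_dim M + card W"
  proof (rule kernel_dim_ge_card_functionals[OF M])
    show "finite W" unfolding W_def using finT finU by blast
    show "W \<subseteq> carrier_vec (m * n)" unfolding W_def using row_carrier_vec[OF _ M] T_lt by auto
    fix v assume v: "v \<in> carrier_vec (m * n)" and W: "\<And>w. w \<in> W \<Longrightarrow> w \<bullet> v = 0"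
    have "row M r \<bullet> v = 0" if r: "r < m * n" for r
    proof -
      have Mr: "M $$ (r, c) = bicoeff (mono_xy (r div n) (r mod n) * nilp ^ k) (c div n) (c mod n)"
        if "c < m * n" for c using r that by (simp add: M_def mult_mat_def)
      have box: "c div n < m" "c mod n < n" if "c < m * n" for c
        using that n by (simp_all add: less_mult_imp_div_less)
      consider "(r div n, r mod n) \<in> T" | "(r div n, r mod n) = (i, j)" | "d < r div n + r mod n"
        unfolding T_def by force
      then show ?thesis
      proof cases
        case 1
        then have "row M (r div n * n + r mod n) \<in> W" unfolding W_def by force
        then show ?thesis using W by simp
      next
        case 2
        then have "row M r = 0\<^sub>v (m * n)"
          using zero box r M by (intro eq_vecI) (simp_all add: Mr k_def box_zero_def)
        then show ?thesis using v by simp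
      next
        case 3
        \<comment> \<open>The row has degree at least d+1, so its nonzero entries have degree at
          least d+1+k = m+n-1-d. These are the positions in \<open>U\<close>, where v
          vanishes.\<close>
        have "M $$ (r, c) * v $ c = 0" if c: "c < m * n" for c
        proof (cases "m + n - 1 - d \<le> c div n + c mod n")
          case True
          then have "(c div n, c mod n) \<in> U" using box[OF c] by (simp add: U_def)
          then have "unit_vec (m * n) (c div n * n + c mod n) \<in> W" unfolding W_def by force
          then have "v $ c = 0" using W[of "unit_vec (m * n) c"] c v by simp
          then show ?thesis by simp
        next
          case False
          then have "c div n + c mod n < r div n + r mod n + k" using 3 d unfolding k_def by linarith
          then have "M $$ (r, c) = 0" unfolding Mr[OF c] bicoeff_mono_xy_mult
            by (auto intro!: bicoeff_nilp_power_low)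
          then show ?thesis by simp
        qed
        then show ?thesis using r M v by (auto simp: scalar_prod_def intro!: sum.neutral)
      qed
    qed
    then show "M *\<^sub>v v = 0\<^sub>v (m * n)" using M by (intro eq_vecI) auto
  qed
  then show ?thesis using cardW unfolding M_def k_def by linarith
qed

text \<open>The summands are the excesses of the first d+1 standard parts over m+n-2-2d, so the sum
  is the rank of that power of N in the standard case.\<close>

lemma sum_odd_reversed: "(\<Sum>t<Suc d. 2 * d + 1 - 2 * t) = (d + 1)\<^sup>2"
proof -
  have "(\<Sum>t<Suc d. 2 * d + 1 - 2 * t) = (\<Sum>t<Suc d. 2 * (Suc d - Suc t) + 1)"
    by (rule sum.cong) auto
  also have "\<dots> = (\<Sum>t<Suc d. 2 * t + 1)" by (rule sum.nat_diff_reindex)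
  also have "\<dots> = (d + 1)\<^sup>2" by (induction d) (simp_all add: power2_eq_square)
  finally show ?thesis .
qed

lemma not_standard_partitionI:
  fixes m n d :: nat
  assumes l: "is_jordan_partition TYPE('a :: field) m n l"
    and d: "i + j = d" "d < m" "m \<le> n"
    and zero: "box_zero m n (mono_xy i j * nilp ^ (m + n - 2 - 2 * d) :: 'a poly poly)"
  shows "\<not> standard_partition m n l"
proof
  assume std: "standard_partition m n l"
  define k where "k = m + n - 2 - 2 * d"
  have len: "length l = m" using std by (simp add: standard_partition_def)
  have nth: "l ! t = m + n - 1 - 2 * t" if "t < m" for t
  proof -
    have "int (l ! (Suc t - 1)) = int m + int n - 2 * int (Suc t) + 1"
      using std that unfolding standard_partition_def by (metis Suc_leI One_nat_def atLeastAtMost_iff le_add1 plus_1_eq_Suc)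
    then show ?thesis using d that by simp
  qed
  \<comment> \<open>Entry t exceeds k exactly when t is at most d, and then by 2d+1-2t. So a
    standard partition forces the rank (d+1)^2, one more than the obstruction allows.\<close>
  have "(\<Sum>t<m. min k (l ! t)) + (d + 1)\<^sup>2 = (\<Sum>t<m. l ! t)"
  proof -
    have "(d + 1)\<^sup>2 = (\<Sum>t\<in>{..<m} \<inter> {..<Suc d}. 2 * d + 1 - 2 * t)"
      using d by (subst sum_odd_reversed[symmetric], intro sum.cong) auto
    also have "\<dots> = (\<Sum>t<m. if t \<in> {..<Suc d} then 2 * d + 1 - 2 * t else 0)"
      by (rule sum.inter_restrict) simp
    finally have "(\<Sum>t<m. min k (l ! t)) + (d + 1)\<^sup>2 =
        (\<Sum>t<m. min k (l ! t) + (if t \<in> {..<Suc d} then 2 * d + 1 - 2 * t else 0))"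
      by (simp add: sum.distrib)
    also have "\<dots> = (\<Sum>t<m. l ! t)"
      using d by (intro sum.cong) (auto simp: nth k_def min_def)
    finally show ?thesis .
  qed
  moreover have "(\<Sum>t<m. l ! t) = m * n"
    using sum_list_jordan_partition[OF l] by (simp add: sum_list_sum_nth len atLeast0LessThan)
  moreover have "(\<Sum>t<m. min k (l ! t)) = kernel_dim (mult_mat m n (nilp ^ k :: 'a poly poly))"
    unfolding kernel_dim_jordan_partition[OF l] by (simp add: sum_list_sum_nth len atLeast0LessThan)
  ultimately show False using kernel_dim_nilp_power_gt[OF d zero] by (simp add: k_def)
qed

subsection \<open>Doubling in characteristic two\<close>

text \<open>The ideal (x^m, y^n) by generators, the form suited to squaring and to multiplication by
  monomials.\<close>

definition box_ideal :: "nat \<Rightarrow> nat \<Rightarrow> 'a :: comm_ring_1 poly poly set" where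
  "box_ideal m n = {mono_xy m 0 * a + mono_xy 0 n * b | a b. True}"

lemma box_idealI: "p = mono_xy m 0 * a + mono_xy 0 n * b \<Longrightarrow> p \<in> box_ideal m n"
  by (auto simp: box_ideal_def)

lemma box_ideal_box_zero: "p \<in> box_ideal m n \<Longrightarrow> box_zero m n p"
  by (auto simp: box_ideal_def box_zero_def bicoeff_mono_xy_mult)

lemma box_ideal_mult:
  assumes "p \<in> box_ideal m n"
  shows "q * p \<in> box_ideal m n"
proof -
  obtain a b where "p = mono_xy m 0 * a + mono_xy 0 n * b"
    using assms by (auto simp: box_ideal_def)
  then show ?thesis
    by (intro box_idealI[of _ _ "q * a" _ "q * b"]) (simp add: algebra_simps)
qed

lemma box_ideal_add:
  assumes "p \<in> box_ideal m n" "q \<in> box_ideal m n"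
  shows "p + q \<in> box_ideal m n"
proof -
  obtain a b where "p = mono_xy m 0 * a + mono_xy 0 n * b"
    using assms by (auto simp: box_ideal_def)
  moreover obtain c d where "q = mono_xy m 0 * c + mono_xy 0 n * d"
    using assms by (auto simp: box_ideal_def)
  ultimately show ?thesis
    by (intro box_idealI[of _ _ "a + c" _ "b + d"]) (simp add: algebra_simps)
qed

lemma mono_xy_mult_box_ideal:
  assumes "p \<in> box_ideal m n"
  shows "mono_xy i j * p \<in> box_ideal (m + i) (n + j)"
proof -
  obtain a b where "p = mono_xy m 0 * a + mono_xy 0 n * b"
    using assms by (auto simp: box_ideal_def)
  then have "mono_xy i j * p = mono_xy (m + i) 0 * (mono_xy 0 j * a) + mono_xy 0 (n + j) * (mono_xy i 0 * b)"
    by (simp add: distrib_left mult.assoc[symmetric] mono_xy_mult add.commute)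
  then show ?thesis by (rule box_idealI)
qed

lemma box_ideal_antimono:
  assumes p: "p \<in> box_ideal m' n'" and "m \<le> m'" "n \<le> n'"
  shows "p \<in> box_ideal m n"
proof -
  obtain a b where "p = mono_xy m' 0 * a + mono_xy 0 n' * b"
    using p by (auto simp: box_ideal_def)
  then have "p = mono_xy m 0 * (mono_xy (m' - m) 0 * a) + mono_xy 0 n * (mono_xy 0 (n' - n) * b)"
    using assms(2,3) by (simp add: mult.assoc[symmetric] mono_xy_mult)
  then show ?thesis by (rule box_idealI)
qed

text \<open>A monomial of degree at least a+b-1 is divisible by x^a or by y^b. The induction splits
  off one factor N = x(1+y) + y, whose two terms lower the demand on a or on b.\<close>

lemma nilp_power_box_ideal:
  "a + b \<le> s + 1 \<Longrightarrow> nilp ^ s \<in> (box_ideal a b :: 'a :: comm_ring_1 poly poly set)"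
proof (induction s arbitrary: a b)
  case 0
  then consider "a = 0" | "b = 0" by linarith
  then show ?case
  proof cases
    case 1
    then show ?thesis by (intro box_idealI[of _ _ 1 _ 0]) (simp add: mono_xy_0)
  next
    case 2
    then show ?thesis by (intro box_idealI[of _ _ 0 _ 1]) (simp add: mono_xy_0)
  qed
next
  case (Suc s)
  show ?case
  proof (cases "a = 0 \<or> b = 0")
    case True
    then show ?thesis
      using box_idealI[of "nilp ^ Suc s" a "nilp ^ Suc s" b 0] box_idealI[of "nilp ^ Suc s" a 0 b "nilp ^ Suc s"]
      by (auto simp: mono_xy_0)
  next
    case False
    then have "nilp ^ s \<in> (box_ideal (a - 1) b :: 'a poly poly set)"
      "nilp ^ s \<in> (box_ideal a (b - 1) :: 'a poly poly set)"
      using False Suc.prems by (auto intro!: Suc.IH)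
    from mono_xy_mult_box_ideal[OF this(1), of 1 0] mono_xy_mult_box_ideal[OF this(2), of 0 1]
    have "mono_xy 1 0 * nilp ^ s \<in> (box_ideal a b :: 'a poly poly set)"
      "mono_xy 0 1 * nilp ^ s \<in> (box_ideal a b :: 'a poly poly set)"
      using False by simp_all
    then have "(1 + mono_xy 0 1) * (mono_xy 1 0 * nilp ^ s) + mono_xy 0 1 * nilp ^ s \<in>
        (box_ideal a b :: 'a poly poly set)"
      by (rule box_ideal_add[OF box_ideal_mult])
    then show ?thesis by (simp add: nilp_eq algebra_simps)
  qed
qed

lemma two_eq_0_poly_poly:
  assumes "CHAR('a :: comm_ring_1) = 2"
  shows "(2 :: 'a poly poly) = 0"
proof -
  have "of_nat 2 = (0 :: 'a)" using assms of_nat_CHAR[where 'a = 'a] by simp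
  then have "(2 :: 'a) = 0" by simp
  moreover have "(2 :: 'a poly poly) = [:[:2:]:]" by (simp add: numeral_poly)
  ultimately show ?thesis by simp
qed

text \<open>The cross term carries a factor 2 and vanishes in characteristic 2.\<close>

lemma square_box_ideal:
  assumes char: "CHAR('a :: comm_ring_1) = 2" and p: "(p :: 'a poly poly) \<in> box_ideal m n"
  shows "p\<^sup>2 \<in> box_ideal (2 * m) (2 * n)"
proof -
  obtain a b where "p = mono_xy m 0 * a + mono_xy 0 n * b"
    using p by (auto simp: box_ideal_def)
  then have "p\<^sup>2 = mono_xy (2 * m) 0 * a\<^sup>2 + mono_xy 0 (2 * n) * b\<^sup>2"
    using two_eq_0_poly_poly[OF char]
    by (simp add: power2_sum power_mult_distrib mono_xy_power mult.commute)
  then show ?thesis by (rule box_idealI)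
qed

text \<open>A monomial of degree d is killed by the power of N that occurs in
  \<open>not_standard_partitionI\<close>. The bounds d < m and m <= n are imposed only where the
  relation is finally used, so that doubling may pass through pairs in either order.\<close>

definition obstructed :: "'a :: comm_ring_1 itself \<Rightarrow> nat \<Rightarrow> nat \<Rightarrow> nat \<Rightarrow> bool" where
  "obstructed F m n d \<longleftrightarrow> (\<exists>i j. i + j = d \<and>
     mono_xy i j * nilp ^ (m + n - 2 - 2 * d) \<in> (box_ideal m n :: 'a poly poly set))"

text \<open>Square the relation, multiply it by \<open>x\<^sup>e y\<^sup>f\<close>, and pass to the larger ideal.\<close>

lemma obstructed_double:
  assumes char: "CHAR('a :: comm_ring_1) = 2" and obs: "obstructed TYPE('a) m' n' d"
    and "m \<le> 2 * m' + e" "n \<le> 2 * n' + f"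
    and exp: "2 * m' + 2 * n' + 2 * e + 2 * f \<le> m + n + 2"
  shows "obstructed TYPE('a) m n (2 * d + e + f)"
proof -
  define s where "s = m' + n' - 2 - 2 * d"
  define t where "t = m + n - 2 - 2 * (2 * d + e + f)"
  have "2 * s = 2 * m' + 2 * n' - (4 + 4 * d)" by (simp add: s_def)
  moreover have "t = m + n - (2 + 4 * d + 2 * e + 2 * f)" by (simp add: t_def)
  \<comment> \<open>The bound \<open>exp\<close> says that the squared relation uses no more than
    the available exponent t; the missing factor N^(t - 2s) is multiplied in afterwards.\<close>
  ultimately have st: "2 * s \<le> t" using exp by linarith
  obtain i j where ij: "i + j = d" "mono_xy i j * nilp ^ s \<in> (box_ideal m' n' :: 'a poly poly set)"
    using obs unfolding obstructed_def s_def by blast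
  have "mono_xy e f * (mono_xy i j * nilp ^ s)\<^sup>2 \<in> (box_ideal (2 * m' + e) (2 * n' + f) :: 'a poly poly set)"
    by (intro mono_xy_mult_box_ideal square_box_ideal char ij(2))
  then have "nilp ^ (t - 2 * s) * (mono_xy e f * (mono_xy i j * nilp ^ s)\<^sup>2) \<in> (box_ideal m n :: 'a poly poly set)"
    by (rule box_ideal_mult[OF box_ideal_antimono[OF _ assms(3,4)]])
  also have "nilp ^ (t - 2 * s) * (mono_xy e f * (mono_xy i j * nilp ^ s)\<^sup>2) =
      mono_xy e f * mono_xy i j ^ 2 * (nilp ^ (t - 2 * s) * nilp ^ (2 * s) :: 'a poly poly)"
    by (simp add: power_mult_distrib power_mult[symmetric] ac_simps)
  also have "nilp ^ (t - 2 * s) * nilp ^ (2 * s) = (nilp ^ t :: 'a poly poly)"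
    using st by (simp add: power_add[symmetric])
  also have "mono_xy e f * mono_xy i j ^ 2 = (mono_xy (2 * i + e) (2 * j + f) :: 'a poly poly)"
    by (simp add: mono_xy_power mono_xy_mult ac_simps)
  finally show ?thesis
    unfolding obstructed_def t_def using ij(1) by (intro exI[of _ "2 * i + e"] exI[of _ "2 * j + f"]) simp
qed

section \<open>Obstructions for each parity of the pair\<close>

lemma obstructed_even_even:
  assumes char: "CHAR('a :: comm_ring_1) = 2" and "even m" "even n"
  shows "obstructed TYPE('a) m n 0"
proof -
  obtain a b where ab: "m = 2 * a" "n = 2 * b" using assms by (auto elim!: evenE)
  \<comment> \<open>N^(a+b-1) vanishes modulo (x^a, y^b). Its square shows that N^(m+n-2) already
    kills the monomial 1, hence d = 0.\<close>
  have "(nilp ^ (a + b - 1))\<^sup>2 \<in> (box_ideal (2 * a) (2 * b) :: 'a poly poly set)"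
    by (intro square_box_ideal char nilp_power_box_ideal) simp
  moreover have "(nilp ^ (a + b - 1))\<^sup>2 = (nilp ^ (m + n - 2) :: 'a poly poly)"
    unfolding power_mult[symmetric] by (rule arg_cong[where f = "(^) nilp"]) (simp add: ab)
  ultimately show ?thesis
    unfolding obstructed_def by (intro exI[of _ 0]) (simp add: ab mono_xy_0)
qed

text \<open>Of the consecutive numbers (m-1)/2 and (m+1)/2 one is even; e is 1 for the smaller and 0
  for the larger. In \<open>obstructed_double\<close> each odd index then costs one of the two units
  of slack in the exponent.\<close>

lemma near_double_even:
  fixes m :: nat
  assumes "odd m"
  obtains a e where "even a" "e \<le> 1" "m + 1 = 2 * a + 2 * e"
proof -
  have "m mod 4 = 1 \<or> m mod 4 = 3" using assms by presburger
  then show ?thesis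
  proof
    assume "m mod 4 = 1"
    then show ?thesis by (intro that[of "m div 2" 1]) presburger+
  next
    assume "m mod 4 = 3"
    then show ?thesis by (intro that[of "(m + 1) div 2" 0]) presburger+
  qed
qed

text \<open>Here the odd one of the two neighbours is taken.\<close>

lemma near_double_odd:
  fixes m :: nat
  assumes "odd m"
  obtains a e where "odd a" "e \<le> 1" "m + 1 = 2 * a + 2 * e"
proof -
  have "m mod 4 = 1 \<or> m mod 4 = 3" using assms by presburger
  then show ?thesis
  proof
    assume "m mod 4 = 1"
    then show ?thesis by (intro that[of "(m + 1) div 2" 0]) presburger+
  next
    assume "m mod 4 = 3"
    then show ?thesis by (intro that[of "m div 2" 1]) presburger+
  qed
qed

text \<open>Both indices are next to doubles of even numbers, so one doubling of the even case with
  d = 0 gives d = e + f, which is at most 2.\<close>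

lemma obstructed_odd_odd:
  assumes char: "CHAR('a :: comm_ring_1) = 2" and "odd m" "odd n" "3 \<le> m" "3 \<le> n"
  shows "\<exists>d\<le>2. obstructed TYPE('a) m n d"
proof -
  obtain a e where a: "even a" "e \<le> 1" "m + 1 = 2 * a + 2 * e" using near_double_even assms by blast
  obtain b f where b: "even b" "f \<le> 1" "n + 1 = 2 * b + 2 * f" using near_double_even assms by blast
  have "obstructed TYPE('a) m n (2 * 0 + e + f)"
    by (rule obstructed_double[OF char obstructed_even_even[OF char a(1) b(1)]]; use assms(2-) a b in linarith)
  then show ?thesis using a b by (intro exI[of _ "e + f"]) simp
qed

text \<open>The partner b is chosen with the parity of a = m/2. If a is even, one doubling of the
  even case suffices. If a is odd, then a >= 3 and the odd case is doubled once more, with 2d + f <=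
  5 < 6 <= m.\<close>

lemma obstructed_even_odd:
  assumes char: "CHAR('a :: comm_ring_1) = 2" and "even m" "odd n" "4 \<le> m" "4 \<le> n"
  shows "\<exists>d<m. obstructed TYPE('a) m n d"
proof -
  obtain a where m: "m = 2 * a" using assms by (auto elim: evenE)
  show ?thesis
  proof (cases "even a")
    case True
    obtain b f where b: "even b" "f \<le> 1" "n + 1 = 2 * b + 2 * f" using near_double_even assms by blast
    have "obstructed TYPE('a) m n (2 * 0 + 0 + f)"
      by (rule obstructed_double[OF char obstructed_even_even[OF char True b(1)]]; use assms(2-) b m in linarith)
    then show ?thesis using assms b by (intro exI[of _ f]) simp
  next
    case False
    obtain b f where b: "odd b" "f \<le> 1" "n + 1 = 2 * b + 2 * f" using near_double_odd assms by blast
    have "3 \<le> a" "3 \<le> b" using assms m b False by presburger+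
    then obtain d where d: "d \<le> 2" "obstructed TYPE('a) a b d"
      using obstructed_odd_odd[OF char False b(1)] by blast
    have "obstructed TYPE('a) m n (2 * d + 0 + f)"
      by (rule obstructed_double[OF char d(2)]; use assms(2-) b m d(1) \<open>3 \<le> a\<close> \<open>3 \<le> b\<close> in linarith)
    then show ?thesis using assms b d \<open>3 \<le> a\<close> m by (intro exI[of _ "2 * d + f"]) simp
  qed
qed

text \<open>The partner a is chosen with the parity of b = n/2. For odd b the odd case is doubled;
  since a >= 3, the new degree satisfies 2d + e <= 4 + e < 5 + 2e <= m.\<close>

lemma obstructed_odd_even:
  assumes char: "CHAR('a :: comm_ring_1) = 2" and "odd m" "even n" "m \<le> n" "3 \<le> m" "m = 3 \<Longrightarrow> 4 dvd n"
  shows "\<exists>d<m. obstructed TYPE('a) m n d"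
proof -
  obtain b where n: "n = 2 * b" using assms by (auto elim: evenE)
  show ?thesis
  proof (cases "even b")
    case True
    obtain a e where a: "even a" "e \<le> 1" "m + 1 = 2 * a + 2 * e" using near_double_even assms by blast
    have "obstructed TYPE('a) m n (2 * 0 + e + 0)"
      by (rule obstructed_double[OF char obstructed_even_even[OF char a(1) True]]; use assms(2-) a n in linarith)
    then show ?thesis using assms a by (intro exI[of _ e]) simp
  next
    case False
    \<comment> \<open>An odd b means that 4 does not divide n, which excludes m = 3.\<close>
    then have m5: "5 \<le> m" using assms n by presburger
    obtain a e where a: "odd a" "e \<le> 1" "m + 1 = 2 * a + 2 * e" using near_double_odd assms by blast
    have "3 \<le> a" "3 \<le> b" using assms m5 n a False by presburger+
    then obtain d where d: "d \<le> 2" "obstructed TYPE('a) a b d"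
      using obstructed_odd_odd[OF char a(1) False] by blast
    have "obstructed TYPE('a) m n (2 * d + e + 0)"
      by (rule obstructed_double[OF char d(2)]; use assms(2-) a n d(1) \<open>3 \<le> a\<close> \<open>3 \<le> b\<close> in linarith)
    then show ?thesis using a d \<open>3 \<le> a\<close> by (intro exI[of _ "2 * d + e"]) simp
  qed
qed

lemma obstructed_exists:
  assumes char: "CHAR('a :: comm_ring_1) = 2" and "0 < m" "m \<le> n"
    and "\<not> (m = 1 \<or> (m = 2 \<and> odd n) \<or> (m = 3 \<and> (\<exists>k :: nat. n = 6 + 4 * k)))"
  shows "\<exists>d<m. obstructed TYPE('a) m n d"
proof (cases "even m")
  case True
  show ?thesis
  proof (cases "even n")
    case True
    with \<open>even m\<close> show ?thesis using obstructed_even_even[OF char] assms by blast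
  next
    case False
    then have "4 \<le> m" using assms \<open>even m\<close> by presburger
    then show ?thesis using obstructed_even_odd[OF char True False] assms by simp
  qed
next
  case False
  then have m3: "3 \<le> m" using assms by presburger
  show ?thesis
  proof (cases "even n")
    case True
    have "4 dvd n" if "m = 3"
    proof (rule ccontr)
      assume "\<not> 4 dvd n"
      \<comment> \<open>The bound n >= 3 excludes n = 2, so n is at least 6 and the truncated
        subtraction is exact.\<close>
      then have "n = 6 + 4 * ((n - 6) div 4)" using True \<open>m \<le> n\<close> that by presburger
      then show False using assms(4) that by blast
    qed
    then show ?thesis using obstructed_odd_even[OF char False True] assms m3 by blast
  next
    case nodd: False
    obtain d where "d \<le> 2" "obstructed TYPE('a) m n d"
      using obstructed_odd_odd[OF char False nodd m3] m3 assms by auto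
    then show ?thesis using m3 by (intro exI[of _ d]) simp
  qed
qed

subsection \<open>The standard cases\<close>

text \<open>The value at p of the linear functional on F[x,y]/(x^m, y^n) that sends x^a y^b to
  \<open>w a b\<close>. A vector in the kernel of \<open>mult_mat m n p\<close> is a functional that
  vanishes on all multiples of p.\<close>

definition pairing :: "nat \<Rightarrow> nat \<Rightarrow> 'a :: comm_ring_1 poly poly \<Rightarrow> (nat \<Rightarrow> nat \<Rightarrow> 'a) \<Rightarrow> 'a" where
  "pairing m n p w = (\<Sum>c<m * n. bicoeff p (c div n) (c mod n) * w (c div n) (c mod n))"

lemma pairing_add: "pairing m n (p + q) w = pairing m n p w + pairing m n q w"
  by (simp add: pairing_def distrib_right sum.distrib)

lemma pairing_box_ideal:
  assumes "p \<in> box_ideal m n"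
  shows "pairing m n p w = 0"
  unfolding pairing_def
proof (rule sum.neutral, rule ballI)
  fix c assume "c \<in> {..<m * n}"
  then have "c div n < m" "c mod n < n"
    by (auto simp: less_mult_imp_div_less intro!: mod_less_divisor Nat.gr0I)
  then show "bicoeff p (c div n) (c mod n) * w (c div n) (c mod n) = 0"
    using box_ideal_box_zero[OF assms] by (simp add: box_zero_def)
qed

lemma pairing_cong:
  assumes "p - q \<in> box_ideal m n"
  shows "pairing m n p w = pairing m n q w"
  using pairing_add[of m n "p - q" q w] pairing_box_ideal[OF assms, of w] by simp

lemma pairing_mono_xy: "pairing m n (mono_xy i j) w = (if i < m \<and> j < n then w i j else 0)"
proof (cases "i < m \<and> j < n")
  case True
  have "pairing m n (mono_xy i j) w = (\<Sum>c<m * n. if c = i * n + j then w i j else 0)"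
    unfolding pairing_def
    by (rule sum.cong) (use True div_mod_pair_iff[of j n _ i] in \<open>auto simp: bicoeff_mono_xy\<close>)
  then show ?thesis using True pair_index_less by simp
next
  case False
  have "mono_xy i j \<in> (box_ideal m n :: 'a poly poly set)"
  proof (cases "i < m")
    case True
    then have "mono_xy i j = mono_xy m 0 * 0 + mono_xy 0 n * (mono_xy i (j - n) :: 'a poly poly)"
      using False by (simp add: mono_xy_mult)
    then show ?thesis by (rule box_idealI)
  next
    case False
    then have "mono_xy i j = mono_xy m 0 * mono_xy (i - m) j + mono_xy 0 n * (0 :: 'a poly poly)"
      by (simp add: mono_xy_mult)
    then show ?thesis by (rule box_idealI)
  qed
  from pairing_box_ideal[OF this] show ?thesis using False by auto
qed

lemma row_mult_mat:
  assumes "i < m" "j < n" "v \<in> carrier_vec (m * n)"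
  shows "row (mult_mat m n p) (i * n + j) \<bullet> v = pairing m n (mono_xy i j * p) (\<lambda>a b. v $ (a * n + b))"
  using assms(3) pair_index_less[OF assms(1,2)] assms(2)
  by (simp add: pairing_def scalar_prod_def mult_mat_def atLeast0LessThan)

text \<open>For lower bounds on the rank: functionals vanishing on the multiples of p are determined
  by their values on \<open>C\<close>, so the kernel embeds into F^C.\<close>

lemma kernel_dim_mult_mat_le:
  assumes C: "C \<subseteq> {..<m} \<times> {..<n}"
    and inj: "\<And>w a b. (\<And>i j. i < m \<Longrightarrow> j < n \<Longrightarrow> pairing m n (mono_xy i j * p) w = 0) \<Longrightarrow>
      (\<And>a b. (a, b) \<in> C \<Longrightarrow> w a b = 0) \<Longrightarrow> a < m \<Longrightarrow> b < n \<Longrightarrow> w a b = 0"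
  shows "kernel_dim (mult_mat m n p) \<le> card C"
proof -
  define W where "W = (\<lambda>(a, b). unit_vec (m * n) (a * n + b) :: 'a vec) ` C"
  have fin: "finite C" using C by (rule finite_subset) simp
  have "kernel_dim (mult_mat m n p) \<le> card W"
  proof (rule kernel_dim_le_card_functionals[OF mult_mat_carrier])
    show "finite W" "W \<subseteq> carrier_vec (m * n)" unfolding W_def using fin by auto
    fix v :: "'a vec"
    assume v: "v \<in> carrier_vec (m * n)" and z: "mult_mat m n p *\<^sub>v v = 0\<^sub>v (m * n)"
      and W: "\<And>w. w \<in> W \<Longrightarrow> w \<bullet> v = 0"
    have "v $ (a * n + b) = 0" if ab: "a < m" "b < n" for a b
    proof (rule inj[OF _ _ ab])
      fix i j assume ij: "i < m" "j < n"
      have "(mult_mat m n p *\<^sub>v v) $ (i * n + j) = 0" using z pair_index_less[OF ij] by simp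
      then show "pairing m n (mono_xy i j * p) (\<lambda>a b. v $ (a * n + b)) = 0"
        using row_mult_mat[OF ij v] pair_index_less[OF ij] by simp
    next
      fix a b assume ab: "(a, b) \<in> C"
      then have "unit_vec (m * n) (a * n + b) \<in> W" unfolding W_def by force
      moreover have "a * n + b < m * n" using ab C by (intro pair_index_less) auto
      ultimately show "v $ (a * n + b) = 0" using W[of "unit_vec (m * n) (a * n + b)"] v by simp
    qed
    then have "v $ c = 0" if "c < m * n" for c
      using that mod_less_divisor[of n c] less_mult_imp_div_less[of c m n]
      by (metis div_mult_mod_eq gr0I mult_0_right not_less_zero)
    then show "v = 0\<^sub>v (m * n)" using v by (intro eq_vecI) auto
  qed
  also have "\<dots> \<le> card C" unfolding W_def using fin by (rule card_image_le)
  finally show ?thesis .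
qed

text \<open>For upper bounds on the rank: the multiples of p involve only the monomials in
  \<open>C\<close>.\<close>

lemma kernel_dim_mult_mat_ge:
  assumes C: "C \<subseteq> {..<m} \<times> {..<n}"
    and ker: "\<And>w i j. (\<And>a b. (a, b) \<in> C \<Longrightarrow> w a b = 0) \<Longrightarrow> i < m \<Longrightarrow> j < n \<Longrightarrow>
      pairing m n (mono_xy i j * p) w = 0"
  shows "m * n \<le> kernel_dim (mult_mat m n p) + card C"
proof -
  define W where "W = (\<lambda>(a, b). unit_vec (m * n) (a * n + b) :: 'a vec) ` C"
  have fin: "finite C" using C by (rule finite_subset) simp
  have "m * n \<le> kernel_dim (mult_mat m n p) + card W"
  proof (rule kernel_dim_ge_card_functionals[OF mult_mat_carrier])
    show "finite W" "W \<subseteq> carrier_vec (m * n)" unfolding W_def using fin by auto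
    fix v :: "'a vec"
    assume v: "v \<in> carrier_vec (m * n)" and W: "\<And>w. w \<in> W \<Longrightarrow> w \<bullet> v = 0"
    have vC: "v $ (a * n + b) = 0" if ab: "(a, b) \<in> C" for a b
    proof -
      have "unit_vec (m * n) (a * n + b) \<in> W" using ab unfolding W_def by force
      moreover have "a * n + b < m * n" using ab C by (intro pair_index_less) auto
      ultimately show "v $ (a * n + b) = 0" using W[of "unit_vec (m * n) (a * n + b)"] v by simp
    qed
    have "row (mult_mat m n p) c \<bullet> v = 0" if c: "c < m * n" for c
    proof -
      have "0 < n" using c by (cases n) auto
      then have ij: "c div n < m" "c mod n < n" using c by (simp_all add: less_mult_imp_div_less)
      show ?thesis using row_mult_mat[OF ij v] ker[OF vC ij] by simp
    qed
    then show "mult_mat m n p *\<^sub>v v = 0\<^sub>v (m * n)" by (intro eq_vecI) auto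
  qed
  also have "card W \<le> card C" unfolding W_def using fin by (rule card_image_le)
  finally show ?thesis by simp
qed

section \<open>Bounds on the number of parts and on the nilpotency index\<close>

lemma nilp_mono_xy: "mono_xy i j * nilp = mono_xy (i + 1) j + mono_xy (i + 1) (j + 1) + mono_xy i (j + 1)"
  by (simp add: nilp_eq distrib_left mono_xy_mult mult.assoc[symmetric])

lemma kernel_dim_nilp_le: "kernel_dim (mult_mat m n (nilp :: 'a :: field poly poly)) \<le> m"
proof (cases "n = 0")
  case False
  have "kernel_dim (mult_mat m n (nilp :: 'a poly poly)) \<le> card ((\<lambda>i. (i, 0 :: nat)) ` {..<m})"
  proof (rule kernel_dim_mult_mat_le)
    show "(\<lambda>i. (i, 0)) ` {..<m} \<subseteq> {..<m} \<times> {..<n}" using False by auto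
    fix w :: "nat \<Rightarrow> nat \<Rightarrow> 'a" and a b :: nat
    assume zero: "\<And>i j. i < m \<Longrightarrow> j < n \<Longrightarrow> pairing m n (mono_xy i j * nilp) w = 0"
      and col: "\<And>a b. (a, b) \<in> (\<lambda>i. (i, 0)) ` {..<m} \<Longrightarrow> w a b = 0" and ab: "a < m" "b < n"
    \<comment> \<open>A kernel vector is determined by its column 0, by descending induction on the row.\<close>
    define u where "u i j = (if i < m \<and> j < n then w i j else 0)" for i j
    \<comment> \<open>Extending w by zero to u keeps the recurrence from N = x + xy + y uniform at
      the border of the box.\<close>
    have rec: "u (i + 1) j + u (i + 1) (j + 1) + u i (j + 1) = 0" if "i < m" "j < n" for i j
      using zero[OF that] by (simp add: nilp_mono_xy pairing_add pairing_mono_xy u_def)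
    have "u i j = 0" if "m \<le> i + k" for i j k
      using that
    proof (induction k arbitrary: i j)
      case 0
      then show ?case by (simp add: u_def)
    next
      case (Suc k)
      then have next_row: "u (i + 1) j = 0" for j by simp
      show ?case
      proof (cases j)
        case 0
        then show ?thesis using col[of i 0] by (simp add: u_def)
      next
        case (Suc j')
        have "u i (Suc j') = 0"
        proof (cases "i < m \<and> Suc j' < n")
          case True
          then show ?thesis using rec[of i j'] next_row by simp
        qed (auto simp: u_def)
        with Suc show ?thesis by simp
      qed
    qed
    from this[of a m b] show "w a b = 0" using ab by (simp add: u_def)
  qed
  also have "\<dots> \<le> m" using card_image_le[of "{..<m}"] by force
  finally show ?thesis .
next
  case True
  then have "kernel_dim (mult_mat m n (nilp :: 'a poly poly)) \<le> card ({} :: (nat \<times> nat) set)"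
    by (intro kernel_dim_mult_mat_le) auto
  then show ?thesis by simp
qed

text \<open>Every part is positive and contributes 1 to the kernel of N, so that kernel counts the
  parts.\<close>

lemma length_jordan_partition_le:
  assumes "is_jordan_partition TYPE('a :: field) m n l"
  shows "length l \<le> m"
proof -
  have eq: "map (min 1) l = map (\<lambda>_. 1) l"
    using pos_jordan_partition[OF assms] by (intro map_cong) (auto simp: min_def Suc_le_eq)
  have "(\<Sum>s\<leftarrow>l. min 1 s) = length l" unfolding eq by (simp add: sum_list_triv)
  then show ?thesis
    using kernel_dim_jordan_partition[OF assms, of 1] kernel_dim_nilp_le[where 'a = 'a, of m n] by simp
qed

lemma box_ideal_power_diff:
  assumes "p - q \<in> box_ideal m n"
  shows "p ^ k - q ^ k \<in> box_ideal m n"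
proof (induction k)
  case 0
  show ?case by (intro box_idealI[of _ _ 0 _ 0]) simp
next
  case (Suc k)
  have "p ^ Suc k - q ^ Suc k = p * (p ^ k - q ^ k) + q ^ k * (p - q)"
    by (simp add: algebra_simps)
  then show ?case using box_ideal_add[OF box_ideal_mult[OF Suc] box_ideal_mult[OF assms]] by simp
qed

lemma pairing_mult_cong:
  assumes "p - q \<in> box_ideal m n"
  shows "pairing m n (u * p) w = pairing m n (u * q) w"
proof (rule pairing_cong)
  show "u * p - u * q \<in> box_ideal m n"
    using box_ideal_mult[OF assms, of u] by (simp add: right_diff_distrib)
qed

lemma nilp_square:
  assumes "CHAR('a :: comm_ring_1) = 2"
  shows "(nilp :: 'a poly poly)\<^sup>2 = mono_xy 2 0 * (1 + mono_xy 0 2) + mono_xy 0 2"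
  using two_eq_0_poly_poly[OF assms]
  by (simp add: nilp_eq power2_sum power_mult_distrib mono_xy_power)

text \<open>N^(m+n-1) = 0, so no part exceeds m+n-1.\<close>

lemma kernel_dim_nilp_power_top:
  "kernel_dim (mult_mat m n (nilp ^ (m + n - 1) :: 'a :: field poly poly)) \<ge> m * n"
proof -
  have "(nilp ^ (m + n - 1) :: 'a poly poly) \<in> box_ideal m n"
    by (rule nilp_power_box_ideal) simp
  then have "m * n \<le> kernel_dim (mult_mat m n (nilp ^ (m + n - 1) :: 'a poly poly)) + card ({} :: (nat \<times> nat) set)"
    by (intro kernel_dim_mult_mat_ge pairing_box_ideal box_ideal_mult) simp_all
  then show ?thesis by simp
qed

section \<open>The three standard families\<close>

lemma standard_partition_1:
  assumes l: "is_jordan_partition TYPE('a :: field) 1 n l" and "0 < n"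
  shows "standard_partition 1 n l"
proof -
  have "length l \<le> 1" "sum_list l = n"
    using length_jordan_partition_le[OF l] sum_list_jordan_partition[OF l] by simp_all
  then have "l = [n]" using \<open>0 < n\<close> by (cases l) auto
  then show ?thesis by (simp add: standard_partition_def)
qed

text \<open>Since n-1 is even, N^n = N y^(n-1) = x y^(n-1) is nonzero, whereas N^(n+1) = 0. So the
  largest part is n+1, and the sum 2n leaves n-1 for the other.\<close>

lemma standard_partition_2:
  assumes char: "CHAR('a :: field) = 2" and l: "is_jordan_partition TYPE('a) 2 n l" and "2 \<le> n" "odd n"
  shows "standard_partition 2 n l"
proof -
  obtain k where n: "n = 2 * k + 1" using \<open>odd n\<close> by (auto elim: oddE)
  have "(nilp\<^sup>2 - mono_xy 0 2 :: 'a poly poly) \<in> box_ideal 2 n"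
    by (intro box_idealI[of _ _ "1 + mono_xy 0 2" _ 0]) (simp add: nilp_square[OF char])
  from box_ideal_mult[OF box_ideal_power_diff[OF this, of k], of nilp]
  have "(nilp ^ n - nilp * mono_xy 0 (n - 1) :: 'a poly poly) \<in> box_ideal 2 n"
    by (simp add: n power_mult[symmetric] mono_xy_power right_diff_distrib)
  moreover have "(nilp * mono_xy 0 (n - 1) - mono_xy 1 (n - 1) :: 'a poly poly) \<in> box_ideal 2 n"
    using \<open>2 \<le> n\<close>
    by (intro box_idealI[of _ _ 0 _ "1 + mono_xy 1 0"]) (simp add: mult.commute[of nilp] nilp_mono_xy distrib_left mono_xy_mult)
  ultimately have "(nilp ^ n - nilp * mono_xy 0 (n - 1)) + (nilp * mono_xy 0 (n - 1) - mono_xy 1 (n - 1) :: 'a poly poly) \<in> box_ideal 2 n"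
    by (rule box_ideal_add)
  then have cong: "nilp ^ n - mono_xy 1 (n - 1) \<in> (box_ideal 2 n :: 'a poly poly set)" by simp
  have "kernel_dim (mult_mat 2 n (nilp ^ n :: 'a poly poly)) \<le> card ({..<2 :: nat} \<times> {..<n} - {(1, n - 1)})"
  proof (rule kernel_dim_mult_mat_le)
    fix w :: "nat \<Rightarrow> nat \<Rightarrow> 'a" and a b :: nat
    assume zero: "\<And>i j. i < 2 \<Longrightarrow> j < n \<Longrightarrow> pairing 2 n (mono_xy i j * nilp ^ n) w = 0"
      and C: "\<And>a b. (a, b) \<in> {..<2} \<times> {..<n} - {(1, n - 1)} \<Longrightarrow> w a b = 0" and ab: "a < 2" "b < n"
    have "w 1 (n - 1) = 0"
      using zero[of 0 0] \<open>2 \<le> n\<close> unfolding pairing_mult_cong[OF cong]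
      by (simp add: pairing_mono_xy mono_xy_0)
    then show "w a b = 0" using C[of a b] ab by auto
  qed auto
  then have "(\<Sum>s\<leftarrow>l. min n s) < 2 * n"
    using \<open>2 \<le> n\<close> by (simp add: kernel_dim_jordan_partition[OF l] card_Diff_singleton)
  moreover have "2 * n \<le> (\<Sum>s\<leftarrow>l. min (n + 1) s)"
    using kernel_dim_nilp_power_top[of 2 n, where 'a = 'a]
    unfolding kernel_dim_jordan_partition[OF l] by simp
  moreover have "length l \<le> 2" "sum_list l = 2 * n"
    using length_jordan_partition_le[OF l] sum_list_jordan_partition[OF l] by simp_all
  moreover have "sorted_wrt (\<ge>) l" using l by (simp add: is_jordan_partition_def)
  ultimately have "l = [n + 1, n - 1]"
    using \<open>2 \<le> n\<close> by (cases l; cases "tl l") (auto simp: min_def split: if_splits)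
  then show ?thesis using \<open>2 \<le> n\<close> by (auto simp: standard_partition_def nth_Cons' of_nat_diff)
qed

text \<open>Since n-2 = 4(k+1), N^(n-2) reduces to y^(n-2), and multiplying by N gives the next
  powers. The ranks of N^(n-1), N^n, N^(n+1), N^(n+2) are at least 4, at most 2, at least 1, and 0;
  together they force the parts n+2, n, n-2.\<close>

lemma standard_partition_3:
  assumes char: "CHAR('a :: field) = 2" and l: "is_jordan_partition TYPE('a) 3 n l" and n: "n = 6 + 4 * k"
  shows "standard_partition 3 n l"
proof -
  let ?I = "box_ideal 3 n :: 'a poly poly set"
  have "(nilp :: 'a poly poly) ^ 4 = (nilp\<^sup>2)\<^sup>2" by simp
  also have "\<dots> = mono_xy 4 0 * (1 + mono_xy 0 2)\<^sup>2 + mono_xy 0 4"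
    using two_eq_0_poly_poly[OF char]
    by (simp add: nilp_square[OF char] power2_sum power_mult_distrib mono_xy_power)
  finally have "nilp ^ 4 - mono_xy 0 4 = mono_xy 3 0 * (mono_xy 1 0 * (1 + mono_xy 0 2)\<^sup>2) + mono_xy 0 n * (0 :: 'a poly poly)"
    by (simp add: mult.assoc[symmetric] mono_xy_mult)
  then have "nilp ^ 4 - mono_xy 0 4 \<in> ?I" by (rule box_idealI)
  from box_ideal_power_diff[OF this, of "k + 1"]
  have c0: "nilp ^ (n - 2) - mono_xy 0 (n - 2) \<in> ?I"
    unfolding power_mult[symmetric] mono_xy_power by (simp add: n)
  have n2: "2 \<le> n" and n3: "Suc (Suc (n - 2)) = n" using n by simp_all
  have n1: "n - 1 = Suc (n - 2)" using n by simp
  have c1: "nilp ^ (n - 1) - (mono_xy 1 (n - 2) + mono_xy 1 (n - 1) + mono_xy 0 (n - 1)) \<in> ?I"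
    using box_ideal_mult[OF c0, of nilp] n1
    by (simp add: right_diff_distrib mult.commute[of nilp "mono_xy _ _"] nilp_mono_xy)
  have c2: "nilp ^ n - mono_xy 2 (n - 2) \<in> ?I"
  proof -
    have "nilp\<^sup>2 * mono_xy 0 (n - 2) - mono_xy 2 (n - 2) \<in> ?I"
      using n2 by (intro box_idealI[of _ _ 0 _ "1 + mono_xy 2 0"])
        (simp add: nilp_square[OF char] distrib_left distrib_right mono_xy_mult n3 numeral_2_eq_2[symmetric])
    from box_ideal_add[OF box_ideal_mult[OF c0, of "nilp\<^sup>2"] this]
    have "nilp\<^sup>2 * (nilp ^ (n - 2) - mono_xy 0 (n - 2)) +
        (nilp\<^sup>2 * mono_xy 0 (n - 2) - mono_xy 2 (n - 2)) \<in> ?I" .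
    moreover have "nilp ^ n = nilp\<^sup>2 * (nilp ^ (n - 2) :: 'a poly poly)"
      by (metis power_add le_add_diff_inverse n2)
    ultimately show ?thesis by (simp only: right_diff_distrib) simp
  qed
  have c3: "nilp ^ (n + 1) - mono_xy 2 (n - 1) \<in> ?I"
  proof -
    have "nilp * mono_xy 2 (n - 2) - mono_xy 2 (n - 1) \<in> ?I"
      using n1 by (intro box_idealI[of _ _ "mono_xy 0 (n - 2) + mono_xy 0 (n - 1)" _ 0])
        (simp add: mult.commute[of nilp "mono_xy _ _"] nilp_mono_xy distrib_left mono_xy_mult)
    from box_ideal_add[OF box_ideal_mult[OF c2, of nilp] this]
    show ?thesis by (simp add: right_diff_distrib)
  qed
  have "kernel_dim (mult_mat 3 n (nilp ^ (n + 1) :: 'a poly poly)) \<le> card ({..<3 :: nat} \<times> {..<n} - {(2, n - 1)})"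
  proof (rule kernel_dim_mult_mat_le)
    fix w :: "nat \<Rightarrow> nat \<Rightarrow> 'a" and a b :: nat
    assume zero: "\<And>i j. i < 3 \<Longrightarrow> j < n \<Longrightarrow> pairing 3 n (mono_xy i j * nilp ^ (n + 1)) w = 0"
      and C: "\<And>a b. (a, b) \<in> {..<3} \<times> {..<n} - {(2, n - 1)} \<Longrightarrow> w a b = 0" and ab: "a < 3" "b < n"
    have "w 2 (n - 1) = 0"
      using zero[of 0 0] n unfolding pairing_mult_cong[OF c3]
      by (simp add: pairing_mono_xy mono_xy_0)
    then show "w a b = 0" using C[of a b] ab by auto
  qed auto
  then have k3: "(\<Sum>s\<leftarrow>l. min (n + 1) s) < 3 * n"
    using n unfolding kernel_dim_jordan_partition[OF l] by (simp add: card_Diff_singleton)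
  \<comment> \<open>Inside the box, multiples of x^2 y^(n-2) involve only x^2 y^(n-2) and x^2
    y^(n-1).\<close>
  have "3 * n \<le> kernel_dim (mult_mat 3 n (nilp ^ n :: 'a poly poly)) + card {(2 :: nat, n - 2), (2, n - 1)}"
  proof (rule kernel_dim_mult_mat_ge)
    fix w :: "nat \<Rightarrow> nat \<Rightarrow> 'a" and i j
    assume C: "\<And>a b. (a, b) \<in> {(2, n - 2), (2, n - 1)} \<Longrightarrow> w a b = 0"
    have "w (i + 2) (j + (n - 2)) = 0" if "i + 2 < 3" "j + (n - 2) < n"
    proof -
      have "i = 0" "j = 0 \<or> j = 1" using that by linarith+
      moreover have "1 + (n - 2) = n - 1" using n by simp
      ultimately show ?thesis using C[of 2 "n - 2"] C[of 2 "n - 1"]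
        by (auto simp: numeral_2_eq_2[symmetric])
    qed
    then show "pairing 3 n (mono_xy i j * nilp ^ n) w = 0"
      unfolding pairing_mult_cong[OF c2] mono_xy_mult pairing_mono_xy by simp
  qed (use n in auto)
  then have k2: "3 * n \<le> (\<Sum>s\<leftarrow>l. min n s) + 2"
    unfolding kernel_dim_jordan_partition[OF l] using n by simp
  have "kernel_dim (mult_mat 3 n (nilp ^ (n - 1) :: 'a poly poly)) \<le>
      card ({..<3 :: nat} \<times> {..<n} - {(0, n - 1), (1, n - 1), (2, n - 2), (2, n - 1)})"
  proof (rule kernel_dim_mult_mat_le)
    fix w :: "nat \<Rightarrow> nat \<Rightarrow> 'a" and a b :: nat
    assume zero: "\<And>i j. i < 3 \<Longrightarrow> j < n \<Longrightarrow> pairing 3 n (mono_xy i j * nilp ^ (n - 1)) w = 0"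
      and C: "\<And>a b. (a, b) \<in> {..<3} \<times> {..<n} - {(0, n - 1), (1, n - 1), (2, n - 2), (2, n - 1)} \<Longrightarrow> w a b = 0"
      and ab: "a < 3" "b < n"
    note zero' = zero[unfolded pairing_mult_cong[OF c1] distrib_left mono_xy_mult pairing_add pairing_mono_xy]
    \<comment> \<open>Multiplying N^(n-1) by x^2, y, x and 1 gives a triangular system that
      determines w at (2, n-1), (1, n-1), (2, n-2) and (0, n-1) in this order.\<close>
    have "w 1 (n - 2) = 0" using C[of 1 "n - 2"] n by simp
    moreover have "w 2 (n - 1) = 0" using zero'[of 2 0] n by simp
    moreover have "w 1 (n - 1) = 0" using zero'[of 0 1] n by simp
    ultimately have "w 2 (n - 2) = 0" "w 0 (n - 1) = 0" "w 2 (n - 1) = 0" "w 1 (n - 1) = 0"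
      using zero'[of 1 0] zero'[of 0 0] n by (simp_all add: numeral_2_eq_2[symmetric])
    then show "w a b = 0"
      by (cases "(a, b) \<in> {(0, n - 1), (1, n - 1), (2, n - 2), (2, n - 1)}") (use C[of a b] ab in auto)
  qed auto
  then have k1: "(\<Sum>s\<leftarrow>l. min (n - 1) s) + 4 \<le> 3 * n"
    using n unfolding kernel_dim_jordan_partition[OF l] by (subst (asm) card_Diff_subset) auto
  have k4: "3 * n \<le> (\<Sum>s\<leftarrow>l. min (n + 2) s)"
    using kernel_dim_nilp_power_top[of 3 n, where 'a = 'a]
    unfolding kernel_dim_jordan_partition[OF l] by simp
  have "length l \<le> 3" and sum: "sum_list l = 3 * n" and sorted: "sorted_wrt (\<ge>) l"
    using length_jordan_partition_le[OF l] sum_list_jordan_partition[OF l] l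
    by (simp_all add: is_jordan_partition_def)
  moreover have "length l = 0 \<or> length l = 1 \<or> length l = 2 \<or> length l = 3" using \<open>length l \<le> 3\<close> by linarith
  then consider "l = []" | a where "l = [a]" | a b where "l = [a, b]" | a b c where "l = [a, b, c]"
    by (auto simp: length_Suc_conv numeral_2_eq_2 numeral_3_eq_3)
  then have "l = [n + 2, n, n - 2]"
  proof cases
    case (4 a b c)
    have abc: "a + b + c = 3 * n" "b \<le> a" "c \<le> b" using sum sorted 4 by auto
    \<comment> \<open>\<open>k4\<close> and \<open>k3\<close> pin the largest part to n+2. Its
      excess over n already uses the 2 allowed by \<open>k2\<close>, so b is at most n. Its excess
      over n-1 is only 3 of the 4 required by \<open>k1\<close>, so b is at least n.\<close>
    have "3 * n \<le> min (n + 2) a + min (n + 2) b + min (n + 2) c" using k4 4 by simp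
    then have "a \<le> n + 2" using abc by linarith
    moreover have "min (n + 1) a + min (n + 1) b + min (n + 1) c < 3 * n" using k3 4 by simp
    then have "n + 2 \<le> a" using abc by linarith
    ultimately have a: "a = n + 2" by simp
    have "3 * n \<le> min n a + min n b + min n c + 2" using k2 4 by simp
    then have "b \<le> n" using a abc by linarith
    moreover have "min (n - 1) a + min (n - 1) b + min (n - 1) c + 4 \<le> 3 * n" using k1 4 by simp
    then have "n \<le> b" using a abc n by linarith
    ultimately have "b = n" "c = n - 2" using a abc by linarith+
    with a have "a = n + 2" "b = n" "c = n - 2" by simp_all
    then show ?thesis using 4 by simp
  \<comment> \<open>With at most two parts \<open>k4\<close> would give 3n <= 2n+4, which fails for
    n >= 6.\<close>
  qed (use k4 n in auto)
  then show ?thesis using n by (auto simp: standard_partition_def nth_Cons' of_nat_diff)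
qed

theorem theorem1:
  fixes m n :: nat
  assumes "CHAR('a :: field) = 2"
    and "0 < m" and "m \<le> n"
  shows "standard_partition m n (jordan_partition TYPE('a) m n) \<longleftrightarrow>
    m = 1 \<or> (m = 2 \<and> odd n) \<or> (m = 3 \<and> (\<exists>k :: nat. n = 6 + 4 * k))"
proof
  have l: "is_jordan_partition TYPE('a) m n (jordan_partition TYPE('a) m n)"
    unfolding jordan_partition_def by (rule theI'[OF is_jordan_partition_ex1])
  {
    assume "m = 1 \<or> (m = 2 \<and> odd n) \<or> (m = 3 \<and> (\<exists>k :: nat. n = 6 + 4 * k))"
    then show "standard_partition m n (jordan_partition TYPE('a) m n)"
    proof (elim disjE conjE exE)
      assume "m = 1"
      then show ?thesis using standard_partition_1[of n] l assms by simp
    next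
      assume "m = 2" "odd n"
      then show ?thesis using standard_partition_2[OF assms(1), of n] l assms by simp
    next
      fix k assume "m = 3" "n = 6 + 4 * k"
      then show ?thesis using standard_partition_3[OF assms(1), of n] l by simp
    qed
  next
    assume std: "standard_partition m n (jordan_partition TYPE('a) m n)"
    show "m = 1 \<or> (m = 2 \<and> odd n) \<or> (m = 3 \<and> (\<exists>k :: nat. n = 6 + 4 * k))"
    proof (rule ccontr)
      assume "\<not> ?thesis"
      then obtain i j where "i + j < m"
        "mono_xy i j * nilp ^ (m + n - 2 - 2 * (i + j)) \<in> (box_ideal m n :: 'a poly poly set)"
        using obstructed_exists[OF assms] unfolding obstructed_def by blast
      then show False
        using not_standard_partitionI[OF l refl _ \<open>m \<le> n\<close> box_ideal_box_zero] std by blast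
    qed
  }
qed

end
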